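(* Let $V_1,V_2:\mathbb{R}\to\mathbb{R}_{\ge0}$ be even uni-modal $C^2$ potentials, let $P\in\mathscr{R}$ have numerical data $(\bar x^{\varsigma_1\varsigma_2},\bar y^{\varsigma_1\varsigma_2})$, and put $k^{\varsigma_1\varsigma_2}=k(\bar x^{\varsigma_1\varsigma_2},\bar y^{\varsigma_1\varsigma_2})$ and $x_0^{\varsigma_1\varsigma_2}=y^{\varsigma_1\varsigma_2}_{k^{\varsigma_1\varsigma_2}+1}=0$. For energies $E>0$ satisfying $$E\le\min\{V_1(x_k^{\varsigma_1\varsigma_2})+V_2(y_{k+1}^{\varsigma_1\varsigma_2}):\varsigma_1,\varsigma_2\in\{\pm\},\ 0\le k\le k^{\varsigma_1\varsigma_2}\},$$ the restricted Hamiltonian flow with impacts $(\varphi^{P,E,E_1}_t)_{t\in\mathbb{R}}$ is identical to the flow without impacts $(\varphi^{E,E_1}_t)_{t\in\mathbb{R}}$ for all $E_1\in[0,E]$. Moreover, if $V_1,V_2$ are quadratic with $V_1=\Omega^2V_2$ and $\Omega$ rational, then this flow is periodic (all its orbits are periodic) for all $E_1\in[0,E]$.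
   Context: Potentials: an even $C^2$ map $V:\mathbb{R}\to\mathbb{R}_{\ge0}$ is called uni-modal if $V(0)=V'(0)=0$, $V'(x)>0$ for all $x>0$, and $\lim_{x\to+\infty}V(x)=+\infty$. Quadratic means $V(x)=\frac12\omega^2x^2$ with $\omega>0$; $\Omega>0$. Polygons: $\Xi$ is the set of sequences $(\bar x,\bar y)=(x_i,y_i)_{i=1}^k$ of points of $\mathbb{R}^2_{>0}$ with $0<x_1<\dots<x_k$ and $0<y_k<\dots<y_1$; set $k(\bar x,\bar y)=k$. $P(\bar x,\bar y)$ is the staircase polygon with consecutive vertices $(0,0),(0,y_1),(x_1,y_1),(x_1,y_2),\dots,(x_{k-1},y_{k-1}),(x_{k-1},y_k),(x_k,y_k),(x_k,0)$. $P(\pm\bar x,\pm\bar y)$ denotes its image under the corresponding reflections in the coordinate axes. $\mathscr{R}$ is the set of polygons $P=P(\bar x^{++},\bar y^{++})\cup P(-\bar x^{-+},\bar y^{-+})\cup P(\bar x^{+-},-\bar y^{+-})\cup P(-\bar x^{--},-\bar y^{--})$ with $(\bar x^{\varsigma_1\varsigma_2},\bar y^{\varsigma_1\varsigma_2})\in\Xi$ such that $y_1^{++}=y_1^{-+}$, $y_1^{+-}=y_1^{--}$, $x^{++}_{k^{++}}=x^{+-}_{k^{+-}}$, $x^{-+}_{k^{-+}}=x^{--}_{k^{--}}$. Flows: $(\varphi^{E,E_1}_t)$ is the flow of $\dot x=p_x,\ \dot p_x=-V_1'(x),\ \dot y=p_y,\ \dot p_y=-V_2'(y)$ restricted to $S_{E,E_1}=\{(p_x,x,p_y,y)\in\mathbb{R}^4:\frac{p_x^2}{2}+V_1(x)=E_1,\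 \frac{p_y^2}{2}+V_2(y)=E-E_1\}$. $(\varphi^{P,E,E_1}_t)$ is the impact flow on $S^P_{E,E_1}=\{(p_x,x,p_y,y)\in S_{E,E_1}:(x,y)\in P\}$: the particle follows the same equations inside $P$ and reflects elastically from the sides of $P$ (at a vertical side $p_x\mapsto-p_x$, at a horizontal side $p_y\mapsto-p_y$); a particle hitting a corner of $P$ stops.
   Formalization: A particle is taken to hit a corner (and stop) only if it arrives there with nonzero momentum; if arrival at rest also stopped it, the claim would fail when E equals the minimum, attained at a concave corner. *)

theory Defs
  imports "HOL-Analysis.Analysis"
begin

section \<open>Potentials\<close>

definition C2 :: "(real \<Rightarrow> real) \<Rightarrow> bool" where
  "C2 V \<longleftrightarrow> (\<forall>x. V differentiable at x) \<and> (\<forall>x. deriv V differentiable at x)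
     \<and> continuous_on UNIV (deriv (deriv V))"

definition unimodal :: "(real \<Rightarrow> real) \<Rightarrow> bool" where
  "unimodal V \<longleftrightarrow> C2 V \<and> (\<forall>x. V x \<ge> 0) \<and> (\<forall>x. V (- x) = V x)
     \<and> V 0 = 0 \<and> deriv V 0 = 0 \<and> (\<forall>x>0. deriv V x > 0) \<and> filterlim V at_top at_top"

definition quadratic :: "(real \<Rightarrow> real) \<Rightarrow> bool" where
  "quadratic V \<longleftrightarrow> (\<exists>\<omega>>0. \<forall>x. V x = 1/2 * \<omega>\<^sup>2 * x\<^sup>2)"


section \<open>Polygons\<close>

text \<open>The closed planar region bounded by the closed polygonal line through the given vertices.\<close>

definition polygonal_line :: "(real \<times> real) list \<Rightarrow> (real \<times> real) set" where
  "polygonal_line vs =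
     (\<Union>i<length vs. closed_segment (vs ! i) (vs ! (Suc i mod length vs)))"

definition polygon :: "(real \<times> real) list \<Rightarrow> (real \<times> real) set" where
  "polygon vs = polygonal_line vs \<union> inside (polygonal_line vs)"

text \<open>A sequence \<open>(x\<^sub>i, y\<^sub>i)\<close>, \<open>1 \<le> i \<le> k\<close>, is a list of length \<open>k\<close>. The coordinate
  functions are indexed from 1 and include the conventions \<open>x\<^sub>0 = 0\<close> and \<open>y\<^sub>k\<^sub>+\<^sub>1 = 0\<close>.\<close>

definition xc :: "(real \<times> real) list \<Rightarrow> nat \<Rightarrow> real" where
  "xc d i = (if 1 \<le> i \<and> i \<le> length d then fst (d ! (i - 1)) else 0)"

definition yc :: "(real \<times> real) list \<Rightarrow> nat \<Rightarrow> real" where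
  "yc d i = (if 1 \<le> i \<and> i \<le> length d then snd (d ! (i - 1)) else 0)"

definition Xi :: "(real \<times> real) list set" where
  "Xi = {d. d \<noteq> [] \<and> (\<forall>i\<in>{1..length d}. 0 < xc d i \<and> 0 < yc d i)
          \<and> (\<forall>i\<in>{1..<length d}. xc d i < xc d (Suc i) \<and> yc d (Suc i) < yc d i)}"

definition staircase_vertices :: "(real \<times> real) list \<Rightarrow> (real \<times> real) list" where
  "staircase_vertices d =
     (0, 0) # concat (map (\<lambda>i. [(xc d (i - 1), yc d i), (xc d i, yc d i)]) [1..<Suc (length d)])
     @ [(xc d (length d), 0)]"

definition staircase :: "(real \<times> real) list \<Rightarrow> (real \<times> real) set" where
  "staircase d = polygon (staircase_vertices d)"

datatype sign = Plus | Minus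

primrec sign_val :: "sign \<Rightarrow> real" where
  "sign_val Plus = 1"
| "sign_val Minus = - 1"

text \<open>\<open>D s1 s2\<close> is the sequence used in the quadrant with signs \<open>s1\<close> of \<open>x\<close> and \<open>s2\<close> of \<open>y\<close>.\<close>

definition admissible_data :: "(sign \<Rightarrow> sign \<Rightarrow> (real \<times> real) list) \<Rightarrow> bool" where
  "admissible_data D \<longleftrightarrow> (\<forall>s1 s2. D s1 s2 \<in> Xi)
     \<and> (\<forall>s2. yc (D Plus s2) 1 = yc (D Minus s2) 1)
     \<and> (\<forall>s1. xc (D s1 Plus) (length (D s1 Plus)) = xc (D s1 Minus) (length (D s1 Minus)))"

definition polygon_of_data :: "(sign \<Rightarrow> sign \<Rightarrow> (real \<times> real) list) \<Rightarrow> (real \<times> real) set" where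
  "polygon_of_data D =
     (\<Union>s1. \<Union>s2. (\<lambda>(x, y). (sign_val s1 * x, sign_val s2 * y)) ` staircase (D s1 s2))"

text \<open>Points in the relative interior of a side of \<open>P\<close>, by the position of the side: near such a
  point \<open>P\<close> is a half-plane. The remaining boundary points of a polygon with vertical and horizontal
  sides are its corners. This refers to the region \<open>P\<close> only, so points such as
  \<open>(0, y\<^sub>1)\<close>, which are vertices of a quarter of \<open>P\<close> but not of \<open>P\<close>, are not corners.\<close>

definition right_side :: "(real \<times> real) set \<Rightarrow> (real \<times> real) set" where
  "right_side P = {q. \<forall>\<^sub>F r in nhds q. r \<in> P \<longleftrightarrow> fst r \<le> fst q}"

definition left_side :: "(real \<times> real) set \<Rightarrow> (real \<times> real) set" where
  "left_side P = {q. \<forall>\<^sub>F r in nhds q. r \<in> P \<longleftrightarrow> fst r \<ge> fst q}"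

definition top_side :: "(real \<times> real) set \<Rightarrow> (real \<times> real) set" where
  "top_side P = {q. \<forall>\<^sub>F r in nhds q. r \<in> P \<longleftrightarrow> snd r \<le> snd q}"

definition bottom_side :: "(real \<times> real) set \<Rightarrow> (real \<times> real) set" where
  "bottom_side P = {q. \<forall>\<^sub>F r in nhds q. r \<in> P \<longleftrightarrow> snd r \<ge> snd q}"

definition corners :: "(real \<times> real) set \<Rightarrow> (real \<times> real) set" where
  "corners P = frontier P - (right_side P \<union> left_side P \<union> top_side P \<union> bottom_side P)"


section \<open>Flows\<close>

text \<open>States are listed as \<open>(p\<^sub>x, x, p\<^sub>y, y)\<close>.\<close>

type_synonym state = "real \<times> real \<times> real \<times> real"

fun pos :: "state \<Rightarrow> real \<times> real" where
  "pos (px, x, py, y) = (x, y)"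

fun momentum :: "state \<Rightarrow> real \<times> real" where
  "momentum (px, x, py, y) = (px, py)"

definition level_set ::
  "(real \<Rightarrow> real) \<Rightarrow> (real \<Rightarrow> real) \<Rightarrow> real \<Rightarrow> real \<Rightarrow> state set" where
  "level_set V1 V2 E E1 =
     {(px, x, py, y). px\<^sup>2 / 2 + V1 x = E1 \<and> py\<^sup>2 / 2 + V2 y = E - E1}"

definition impact_level_set ::
  "(real \<Rightarrow> real) \<Rightarrow> (real \<Rightarrow> real) \<Rightarrow> (real \<times> real) set \<Rightarrow> real \<Rightarrow> real \<Rightarrow> state set" where
  "impact_level_set V1 V2 P E E1 = {z \<in> level_set V1 V2 E E1. pos z \<in> P}"

fun ham_field :: "(real \<Rightarrow> real) \<Rightarrow> (real \<Rightarrow> real) \<Rightarrow> state \<Rightarrow> state" where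
  "ham_field V1 V2 (px, x, py, y) = (- deriv V1 x, px, - deriv V2 y, py)"

definition solves_on ::
  "(real \<Rightarrow> real) \<Rightarrow> (real \<Rightarrow> real) \<Rightarrow> real set \<Rightarrow> (real \<Rightarrow> state) \<Rightarrow> bool" where
  "solves_on V1 V2 I c \<longleftrightarrow>
     (\<forall>t\<in>I. (c has_vector_derivative ham_field V1 V2 (c t)) (at t within I))"

text \<open>For uni-modal potentials the field is \<open>C\<^sup>1\<close> and energy levels are compact, so there is exactly
  one global solution through each state.\<close>

definition flow :: "(real \<Rightarrow> real) \<Rightarrow> (real \<Rightarrow> real) \<Rightarrow> real \<Rightarrow> state \<Rightarrow> state" where
  "flow V1 V2 t z = (THE c. solves_on V1 V2 UNIV c \<and> c 0 = z) t"

text \<open>Elastic reflection of a state whose momentum points out of \<open>P\<close> at a side.\<close>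

fun reflect :: "(real \<times> real) set \<Rightarrow> state \<Rightarrow> state" where
  "reflect P (px, x, py, y) =
     (if (x, y) \<in> right_side P \<and> px > 0 \<or> (x, y) \<in> left_side P \<and> px < 0 then (- px, x, py, y)
      else if (x, y) \<in> top_side P \<and> py > 0 \<or> (x, y) \<in> bottom_side P \<and> py < 0 then (px, x, - py, y)
      else (px, x, py, y))"

text \<open>A particle that is momentarily at rest when it reaches a corner does not collide: it neither
  pushes against a side nor is it deflected, and the forces draw it back into \<open>P\<close>. Hence only an
  arrival with nonzero momentum counts as hitting a corner.\<close>

definition hits_corner :: "(real \<times> real) set \<Rightarrow> state \<Rightarrow> bool" where
  "hits_corner P z \<longleftrightarrow> pos z \<in> corners P \<and> momentum z \<noteq> (0, 0)"

text \<open>Motion for times \<open>t \<ge> 0\<close>. The state \<open>c t\<close> at the moment of an impact is the incoming one, so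
  \<open>c\<close> solves the equations up to and including \<open>t\<close>, and continues after \<open>t\<close> as the solution
  starting from the reflected state. (If no impact takes place at \<open>t\<close>, the reflected state is
  \<open>c t\<close> itself.) After hitting a corner the state is frozen.\<close>

definition forward_impact_motion ::
  "(real \<Rightarrow> real) \<Rightarrow> (real \<Rightarrow> real) \<Rightarrow> (real \<times> real) set \<Rightarrow> (real \<Rightarrow> state) \<Rightarrow> bool" where
  "forward_impact_motion V1 V2 P c \<longleftrightarrow>
     (\<forall>t\<ge>0. pos (c t) \<in> P) \<and>
     (\<forall>t>0. (\<forall>s\<in>{0..<t}. \<not> hits_corner P (c s)) \<longrightarrow>
        (\<exists>\<epsilon>>0. \<epsilon> \<le> t \<and> solves_on V1 V2 {t - \<epsilon><..t} c)) \<and>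
     (\<forall>t\<ge>0. \<not> hits_corner P (c t) \<longrightarrow>
        (\<exists>\<epsilon>>0. solves_on V1 V2 {t..<t + \<epsilon>} (c(t := reflect P (c t))))) \<and>
     (\<forall>t\<ge>0. hits_corner P (c t) \<longrightarrow> (\<forall>s\<ge>t. c s = c t))"

text \<open>Negative times are governed by the same law, read backwards.\<close>

fun time_reversal :: "state \<Rightarrow> state" where
  "time_reversal (px, x, py, y) = (- px, x, - py, y)"

definition impact_motion ::
  "(real \<Rightarrow> real) \<Rightarrow> (real \<Rightarrow> real) \<Rightarrow> (real \<times> real) set \<Rightarrow> (real \<Rightarrow> state) \<Rightarrow> bool" where
  "impact_motion V1 V2 P c \<longleftrightarrow>
     forward_impact_motion V1 V2 P c \<and>
     forward_impact_motion V1 V2 P (\<lambda>t. time_reversal (c (- t)))"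

definition impact_flow ::
  "(real \<Rightarrow> real) \<Rightarrow> (real \<Rightarrow> real) \<Rightarrow> (real \<times> real) set \<Rightarrow> real \<Rightarrow> state \<Rightarrow> state" where
  "impact_flow V1 V2 P t z = (THE c. impact_motion V1 V2 P c \<and> c 0 = z) t"

end

theory Submission
  imports Defs
begin

text \<open>The staircase region is enclosed by its polygonal line because its frontier lies on that line,
  so by the bound on \<open>E\<close> and monotonicity every \<open>(x, y)\<close> with \<open>V1 x + V2 y \<le> E\<close> lies in \<open>P\<close>. Since
  \<open>{V1 x + V2 y < E}\<close> is open, a state on the level set can only meet the boundary of \<open>P\<close> where
  \<open>V1 x + V2 y = E\<close>, that is, with zero momentum; such a state neither hits a corner nor is reflected.
  Hence a curve starting on the level set is a motion with impacts iff it is a motion without impacts: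
  the two uniqueness predicates defining the flows coincide, and neither existence nor uniqueness of
  solutions is needed for the comparison. For quadratic potentials the explicit solution is unique by
  conservation of energy applied to the difference of two solutions.\<close>

section \<open>Staircase polygons\<close>

lemma length_concat_pairs: "length (concat (map (\<lambda>i. [f i, g i]) [1..<Suc n])) = 2 * n"
  by (induction n) auto

lemma concat_pairs_nth:
  fixes f g :: "nat \<Rightarrow> 'a"
  assumes "j < n"
  shows "concat (map (\<lambda>i. [f i, g i]) [1..<Suc n]) ! (2 * j) = f (Suc j)"
    and "concat (map (\<lambda>i. [f i, g i]) [1..<Suc n]) ! Suc (2 * j) = g (Suc j)"
proof -
  have "concat (map (\<lambda>i. [f i, g i]) [1..<Suc n]) ! (2 * j) = f (Suc j) \<and>
        concat (map (\<lambda>i. [f i, g i]) [1..<Suc n]) ! Suc (2 * j) = g (Suc j)"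
    using assms
  proof (induction n)
    case 0
    then show ?case by simp
  next
    case (Suc n)
    have split: "concat (map (\<lambda>i. [f i, g i]) [1..<Suc (Suc n)]) =
        concat (map (\<lambda>i. [f i, g i]) [1..<Suc n]) @ [f (Suc n), g (Suc n)]"
      by simp
    show ?case
    proof (cases "j = n")
      case True
      then show ?thesis
        unfolding split nth_append length_concat_pairs by simp
    next
      case False
      with Suc.prems have "j < n" by simp
      with Suc.IH show ?thesis
        unfolding split nth_append length_concat_pairs by simp
    qed
  qed
  then show "concat (map (\<lambda>i. [f i, g i]) [1..<Suc n]) ! (2 * j) = f (Suc j)"
    and "concat (map (\<lambda>i. [f i, g i]) [1..<Suc n]) ! Suc (2 * j) = g (Suc j)"
    by auto
qed

lemma length_staircase_vertices: "length (staircase_vertices d) = 2 * length d + 2"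
  using length_concat_pairs[of "\<lambda>i. (xc d (i - 1), yc d i)" "\<lambda>i. (xc d i, yc d i)" "length d"]
  by (simp add: staircase_vertices_def)

text \<open>The positions \<open>2 * i - 1\<close> and \<open>2 * i\<close> hold the left and right
  ends of the \<open>i\<close>-th step, so the edges join neighbouring positions of the
  list.\<close>

lemma staircase_vertices_nth:
  shows "staircase_vertices d ! 0 = (0, 0)"
    and "1 \<le> i \<Longrightarrow> i \<le> length d \<Longrightarrow> staircase_vertices d ! (2 * i - 1) = (xc d (i - 1), yc d i)"
    and "1 \<le> i \<Longrightarrow> i \<le> length d \<Longrightarrow> staircase_vertices d ! (2 * i) = (xc d i, yc d i)"
    and "staircase_vertices d ! (2 * length d + 1) = (xc d (length d), 0)"
proof -
  define f where "f i = (xc d (i - 1), yc d i)" for i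
  define g where "g i = (xc d i, yc d i)" for i
  have vs: "staircase_vertices d =
      (0, 0) # concat (map (\<lambda>i. [f i, g i]) [1..<Suc (length d)]) @ [(xc d (length d), 0)]"
    unfolding staircase_vertices_def f_def g_def ..
  show "staircase_vertices d ! 0 = (0, 0)"
    by (simp add: vs)
  show "staircase_vertices d ! (2 * length d + 1) = (xc d (length d), 0)"
    unfolding vs using length_concat_pairs[of f g "length d"] by (simp del: upt_Suc add: nth_append)
  assume "1 \<le> i" "i \<le> length d"
  then obtain j where j: "i = Suc j" "j < length d"
    by (cases i) auto
  have "staircase_vertices d ! (2 * i - 1) = f (Suc j)"
    unfolding vs using j concat_pairs_nth(1)[OF j(2), of f g] length_concat_pairs[of f g "length d"]
    by (simp del: upt_Suc add: nth_append)
  then show "staircase_vertices d ! (2 * i - 1) = (xc d (i - 1), yc d i)"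
    using j by (simp add: f_def)
  have "staircase_vertices d ! (2 * i) = g (Suc j)"
    unfolding vs using j concat_pairs_nth(2)[OF j(2), of f g] length_concat_pairs[of f g "length d"]
    by (simp del: upt_Suc add: nth_append)
  then show "staircase_vertices d ! (2 * i) = (xc d i, yc d i)"
    using j by (simp add: g_def)
qed

lemma closed_segment_horizontal:
  fixes a b c x :: real
  assumes "a \<le> x" "x \<le> b"
  shows "(x, c) \<in> closed_segment (a, c) (b, c)"
proof (cases "a = b")
  case True
  with assms show ?thesis by simp
next
  case False
  define u where "u = (x - a) / (b - a)"
  have "u * (b - a) = x - a"
    using False by (simp add: u_def)
  then have "(1 - u) * a + u * b = x"
    by (simp add: algebra_simps)
  moreover have "0 \<le> u" "u \<le> 1"
    using assms False by (auto simp: u_def)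
  ultimately show ?thesis
    unfolding closed_segment_def by (auto intro!: exI[of _ u] simp: algebra_simps)
qed

lemma closed_segment_vertical:
  fixes a b c y :: real
  assumes "a \<le> y" "y \<le> b"
  shows "(c, y) \<in> closed_segment (c, a) (c, b)"
proof (cases "a = b")
  case True
  with assms show ?thesis by simp
next
  case False
  define u where "u = (y - a) / (b - a)"
  have "u * (b - a) = y - a"
    using False by (simp add: u_def)
  then have "(1 - u) * a + u * b = y"
    by (simp add: algebra_simps)
  moreover have "0 \<le> u" "u \<le> 1"
    using assms False by (auto simp: u_def)
  ultimately show ?thesis
    unfolding closed_segment_def by (auto intro!: exI[of _ u] simp: algebra_simps)
qed

text \<open>Besides the two sides on the axes, the edges are the steps and the drops after them. The
  last drop, down to the x-axis, fits the general form because \<open>yc\<close> is 0 beyond the end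
  of the list.\<close>

lemma staircase_line_edges:
  assumes "d \<noteq> []"
  shows "closed_segment (0, 0) (0, yc d 1) \<subseteq> polygonal_line (staircase_vertices d)"
    and "closed_segment (xc d (length d), 0) (0, 0) \<subseteq> polygonal_line (staircase_vertices d)"
    and "1 \<le> i \<Longrightarrow> i \<le> length d \<Longrightarrow>
      closed_segment (xc d (i - 1), yc d i) (xc d i, yc d i) \<subseteq> polygonal_line (staircase_vertices d)"
    and "1 \<le> i \<Longrightarrow> i \<le> length d \<Longrightarrow>
      closed_segment (xc d i, yc d i) (xc d i, yc d (Suc i)) \<subseteq> polygonal_line (staircase_vertices d)"
proof -
  let ?vs = "staircase_vertices d"
  note nth = staircase_vertices_nth[where d = d] and len = length_staircase_vertices[of d]
  have K: "1 \<le> length d"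
    using assms by (cases d) auto
  have edge: "closed_segment (?vs ! j) (?vs ! (Suc j mod length ?vs)) \<subseteq> polygonal_line ?vs"
    if "j < 2 * length d + 2" for j
    using that unfolding polygonal_line_def len[symmetric] by blast
  show "closed_segment (0, 0) (0, yc d 1) \<subseteq> polygonal_line ?vs"
    using edge[of 0] nth(1) nth(2)[of 1] K by (simp add: len xc_def)
  show "closed_segment (xc d (length d), 0) (0, 0) \<subseteq> polygonal_line ?vs"
    using edge[of "2 * length d + 1"] nth(1) nth(4) by (simp add: len)
  assume i: "1 \<le> i" "i \<le> length d"
  have "Suc (2 * i - 1) = 2 * i"
    using i by simp
  then show "closed_segment (xc d (i - 1), yc d i) (xc d i, yc d i) \<subseteq> polygonal_line ?vs"
    using edge[of "2 * i - 1"] nth(2)[OF i] nth(3)[OF i] i by (simp add: len)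
  have "?vs ! Suc (2 * i) = (xc d i, yc d (Suc i))"
  proof (cases "i = length d")
    case True
    then show ?thesis
      using nth(4) by (simp add: yc_def)
  next
    case False
    then show ?thesis
      using nth(2)[of "Suc i"] i by simp
  qed
  then show "closed_segment (xc d i, yc d i) (xc d i, yc d (Suc i)) \<subseteq> polygonal_line ?vs"
    using edge[of "2 * i"] nth(3)[OF i] i by (simp add: len)
qed

section \<open>The region enclosed by a staircase\<close>

lemma Xi_xc_mono:
  assumes "d \<in> Xi" "i \<le> j" "j \<le> length d"
  shows "xc d i \<le> xc d j"
  using assms(2,3)
proof (induction j rule: dec_induct)
  case base
  then show ?case by simp
next
  case (step n)
  \<comment> \<open>For \<open>n = 0\<close> the default value \<open>xc d 0 = 0\<close> meets the
    positive \<open>xc d 1\<close>. Starting the chain at index 0 also makes every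
    \<open>xc d j\<close> nonnegative.\<close>
  have "xc d n \<le> xc d (Suc n)"
  proof (cases "n = 0")
    case True
    have "0 < xc d 1"
      using assms(1) step.prems unfolding Xi_def by auto
    then show ?thesis
      using True by (simp add: xc_def)
  next
    case False
    then show ?thesis
      using assms(1) step.prems unfolding Xi_def by (auto intro: less_imp_le)
  qed
  with step show ?case by simp
qed

text \<open>Index 0 is excluded, since its default value 0 would break the decreasing order.\<close>

lemma Xi_yc_antimono:
  assumes "d \<in> Xi" "1 \<le> i" "i \<le> j" "j \<le> length d"
  shows "yc d j \<le> yc d i"
  using assms(3,4)
proof (induction j rule: dec_induct)
  case base
  then show ?case by simp
next
  case (step n)
  have "yc d (Suc n) \<le> yc d n"
    using assms(1,2) step unfolding Xi_def by (auto intro: less_imp_le)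
  with step show ?case by simp
qed

text \<open>The frontier of the union \<open>R\<close> of rectangles lies on the polygonal line. A
  component of the complement of the line that meets \<open>R\<close> therefore cannot leave
  \<open>R\<close>, so it is bounded and belongs to the inside of the line.\<close>

lemma staircase_superset:
  assumes d: "d \<in> Xi"
  shows "(\<Union>i\<in>{1..length d}. {0..xc d i} \<times> {0..yc d i}) \<subseteq> staircase d"
proof -
  define R where "R = (\<Union>i\<in>{1..length d}. {0..xc d i} \<times> {0..yc d i})"
  let ?L = "polygonal_line (staircase_vertices d)"
  have ne: "d \<noteq> []"
    using d by (simp add: Xi_def)
  have clR: "closed R"
    unfolding R_def by (intro closed_UN ballI closed_Times closed_real_atLeastAtMost) simp
  have bdR: "bounded R"
    unfolding R_def by (intro bounded_UN ballI bounded_Times bounded_closed_interval) simp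
  have "frontier R \<subseteq> ?L"
  proof
    fix q assume "q \<in> frontier R"
    then have qR: "q \<in> R" and qI: "q \<notin> interior R"
      using clR by (auto simp: frontier_def closure_closed)
    obtain x y where q: "q = (x, y)" by (cases q)
    from qR q obtain i0 where i0: "i0 \<in> {1..length d}" "0 \<le> x" "x \<le> xc d i0" "0 \<le> y" "y \<le> yc d i0"
      by (auto simp: R_def)
    \<comment> \<open>The first step whose right end is not to the left of \<open>x\<close>:
      minimality gives \<open>xc d (i - 1) \<le> x\<close>, and \<open>i \<le> i0\<close> gives
      \<open>y \<le> yc d i\<close>.\<close>
    define i where "i = (LEAST i. 1 \<le> i \<and> x \<le> xc d i)"
    have i1: "1 \<le> i" "x \<le> xc d i"
      using LeastI[of "\<lambda>i. 1 \<le> i \<and> x \<le> xc d i" i0] i0 by (auto simp: i_def)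
    have ii0: "i \<le> i0"
      unfolding i_def using i0 by (intro Least_le) auto
    have iK: "i \<le> length d" and yi: "y \<le> yc d i"
      using ii0 i0 i1 Xi_yc_antimono[OF d i1(1) ii0] by auto
    have below: "xc d (i - 1) \<le> x"
    proof (cases "i = 1")
      case True
      then show ?thesis
        using i0 by (simp add: xc_def)
    next
      case False
      then have "i - 1 < i" "1 \<le> i - 1"
        using i1 by auto
      then show ?thesis
        using not_less_Least[of "i - 1" "\<lambda>i. 1 \<le> i \<and> x \<le> xc d i"] by (auto simp: i_def)
    qed
    \<comment> \<open>A point strictly inside one rectangle is interior to \<open>R\<close> and so
      not on its frontier.\<close>
    have not_below: "\<not> (0 < x \<and> x < xc d j \<and> 0 < y \<and> y < yc d j)" if j: "j \<in> {1..length d}" for j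
    proof
      assume "0 < x \<and> x < xc d j \<and> 0 < y \<and> y < yc d j"
      then have "q \<in> {0<..<xc d j} \<times> {0<..<yc d j}"
        by (simp add: q)
      moreover have "{0<..<xc d j} \<times> {0<..<yc d j} \<subseteq> R"
        using j by (force simp: R_def)
      moreover have "open ({0<..<xc d j} \<times> {0<..<yc d j})"
        by (intro open_Times) auto
      ultimately show False
        using qI interior_maximal by blast
    qed
    consider "x = 0" | "y = 0" | "0 < x" "0 < y" "y = yc d i" | "0 < x" "0 < y" "y < yc d i"
      using i0 yi by fastforce
    then show "q \<in> ?L"
    proof cases
      case 1
      have "yc d i \<le> yc d 1"
        using Xi_yc_antimono[OF d _ i1(1) iK] by simp
      then have "q \<in> closed_segment (0, 0) (0, yc d 1)"
        using 1 i0 yi q by (auto intro!: closed_segment_vertical)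
      then show ?thesis
        using staircase_line_edges(1)[OF ne] by blast
    next
      case 2
      have "xc d i \<le> xc d (length d)"
        using Xi_xc_mono[OF d iK] by simp
      then have "q \<in> closed_segment (0, 0) (xc d (length d), 0)"
        using 2 i0 i1 q by (auto intro!: closed_segment_horizontal)
      then show ?thesis
        using staircase_line_edges(2)[OF ne] by (auto simp: closed_segment_commute)
    next
      case 3
      then have "q \<in> closed_segment (xc d (i - 1), yc d i) (xc d i, yc d i)"
        using below i1 q by (auto intro!: closed_segment_horizontal)
      then show ?thesis
        using staircase_line_edges(3)[OF ne i1(1) iK] by blast
    next
      case 4
      \<comment> \<open>Not lying strictly inside rectangle \<open>i\<close> forces
        \<open>x = xc d i\<close>. This is left of \<open>xc d (Suc i)\<close>, so the same argument
        for the next rectangle, if there is one, bounds \<open>y\<close> from below.\<close>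
      have x: "x = xc d i"
        using not_below[of i] 4 i1 iK by force
      have "yc d (Suc i) \<le> y"
      proof (cases "i = length d")
        case True
        then show ?thesis
          using 4 by (simp add: yc_def)
      next
        case False
        then have "Suc i \<in> {1..length d}" "xc d i < xc d (Suc i)"
          using d i1 iK unfolding Xi_def by auto
        then show ?thesis
          using not_below[of "Suc i"] 4 x by force
      qed
      then have "q \<in> closed_segment (xc d i, yc d (Suc i)) (xc d i, yc d i)"
        using 4 x q by (auto intro!: closed_segment_vertical)
      then show ?thesis
        using staircase_line_edges(4)[OF ne i1(1) iK] by (auto simp: closed_segment_commute)
    qed
  qed
  then have "q \<in> ?L \<union> inside ?L" if q: "q \<in> R" for q
  proof (cases "q \<in> ?L")
    case True
    then show ?thesis by simp
  next
    case False
    let ?C = "connected_component_set (- ?L) q"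
    have "connected ?C" "q \<in> ?C" "?C \<subseteq> - ?L"
      using False connected_component_subset[of "- ?L" q]
      by (auto simp: connected_component_refl)
    \<comment> \<open>A connected set meeting both \<open>R\<close> and its complement would meet
      the frontier of \<open>R\<close>, hence the line.\<close>
    then have "?C \<subseteq> R"
      using connected_Int_frontier[of ?C R] \<open>frontier R \<subseteq> ?L\<close> q by blast
    then have "bounded ?C"
      using bdR bounded_subset by blast
    then show ?thesis
      using False by (simp add: inside_def)
  qed
  then show ?thesis
    unfolding staircase_def polygon_def R_def by blast
qed

section \<open>Energy levels and the polygon\<close>

lemma unimodal_has_derivative:
  assumes "unimodal V"
  shows "(V has_real_derivative deriv V x) (at x)"
  using assms unfolding unimodal_def C2_def
  by (simp add: DERIV_deriv_iff_real_differentiable)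

lemma unimodal_continuous_on: "unimodal V \<Longrightarrow> continuous_on UNIV V"
  using unimodal_has_derivative DERIV_isCont continuous_at_imp_continuous_on by blast

lemma unimodal_strict_mono:
  assumes "unimodal V" "0 \<le> a" "a < b"
  shows "V a < V b"
\<comment> \<open>The derivative vanishes at 0; asking for positivity on the open interval only
  admits \<open>a = 0\<close>.\<close>
proof (rule DERIV_pos_imp_increasing_open[OF assms(3)])
  fix x assume "a < x" "x < b"
  then show "\<exists>y. (V has_real_derivative y) (at x) \<and> 0 < y"
    using assms unimodal_has_derivative[OF assms(1)] unfolding unimodal_def by force
next
  show "continuous_on {a..b} V"
    using unimodal_continuous_on[OF assms(1)] continuous_on_subset by blast
qed

lemma unimodal_mono:
  assumes "unimodal V" "0 \<le> a" "a \<le> b"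
  shows "V a \<le> V b"
  using unimodal_strict_mono[OF assms(1,2), of b] assms(3) by (cases "a = b") auto

lemma unimodal_abs: "unimodal V \<Longrightarrow> V \<bar>x\<bar> = V x"
  by (simp add: unimodal_def abs_if)

text \<open>A point of the quadrant outside every rectangle dominates some
  \<open>(xc d k, yc d (k + 1))\<close>, strictly in one coordinate. Its potential energy then
  exceeds the value there, which is at least \<open>E\<close>.\<close>

lemma sublevel_subset_staircase:
  assumes V: "unimodal V1" "unimodal V2" and d: "d \<in> Xi"
    and E: "\<And>k. k \<le> length d \<Longrightarrow> E \<le> V1 (xc d k) + V2 (yc d (k + 1))"
    and x: "0 \<le> x" and y: "0 \<le> y" and le: "V1 x + V2 y \<le> E"
  shows "(x, y) \<in> staircase d"
proof (rule ccontr)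
  assume "(x, y) \<notin> staircase d"
  then have out: "xc d i < x \<or> yc d i < y" if "i \<in> {1..length d}" for i
    using that staircase_superset[OF d] x y by force
  \<comment> \<open>The last index with \<open>xc d k < x\<close>, or 0 if there is none; putting 0
    into \<open>A\<close> guarantees a maximum.\<close>
  define A where "A = {k. k \<le> length d \<and> (k = 0 \<or> xc d k < x)}"
  define k where "k = Max A"
  have fin: "finite A" "A \<noteq> {}"
    by (auto simp: A_def)
  have "k \<in> A"
    unfolding k_def using fin by (rule Max_in)
  then have k: "k \<le> length d" "k = 0 \<or> xc d k < x"
    by (auto simp: A_def)
  have xk: "0 \<le> xc d k"
    using Xi_xc_mono[OF d, of 0 k] k by (simp add: xc_def)
  have yk: "yc d (k + 1) < y \<and> 0 \<le> yc d (k + 1)" if "k < length d"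
  proof -
    \<comment> \<open>Maximality gives \<open>x \<le> xc d (k + 1)\<close>, so the point can miss
      rectangle \<open>k + 1\<close> only by being above it.\<close>
    have "k + 1 \<notin> A"
      using Max_ge[OF fin(1), of "k + 1"] by (auto simp: k_def)
    then have "\<not> xc d (k + 1) < x"
      using that by (auto simp: A_def)
    then show ?thesis
      using out[of "k + 1"] that d by (auto simp: Xi_def less_imp_le)
  qed
  have "V1 (xc d k) + V2 (yc d (k + 1)) < V1 x + V2 y"
  proof (cases "k < length d")
    case True
    have "xc d k \<le> x"
      using k x by (auto simp: xc_def)
    then show ?thesis
      using yk[OF True] xk unimodal_mono[OF V(1)] unimodal_strict_mono[OF V(2)]
      by (intro add_le_less_mono) auto
  next
    \<comment> \<open>Beyond the last step \<open>yc d (k + 1)\<close> is 0, and the strict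
      inequality comes from \<open>x\<close> instead of \<open>y\<close>.\<close>
    case False
    then have kK: "k = length d"
      using k by simp
    moreover have "k \<noteq> 0"
      using d kK by (auto simp: Xi_def)
    ultimately have "xc d k < x" "yc d (k + 1) = 0"
      using k by (auto simp: yc_def)
    then show ?thesis
      using xk y unimodal_strict_mono[OF V(1)] unimodal_mono[OF V(2)]
      by (intro add_less_le_mono) auto
  qed
  with E[OF k(1)] le show False
    by simp
qed

text \<open>Evenness of both potentials moves the point into the first quadrant; the signs of its
  coordinates select the staircase and the reflection back.\<close>

lemma sublevel_subset_polygon:
  assumes V: "unimodal V1" "unimodal V2" and D: "admissible_data D"
    and E: "\<And>s1 s2 k. k \<le> length (D s1 s2) \<Longrightarrow>
      E \<le> V1 (xc (D s1 s2) k) + V2 (yc (D s1 s2) (k + 1))"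
    and le: "V1 x + V2 y \<le> E"
  shows "(x, y) \<in> polygon_of_data D"
proof -
  define sg where "sg u = (if u < 0 then Minus else Plus)" for u :: real
  have sg: "sign_val (sg u) * \<bar>u\<bar> = u" for u
    by (simp add: sg_def)
  have "(\<bar>x\<bar>, \<bar>y\<bar>) \<in> staircase (D (sg x) (sg y))"
    using D le by (intro sublevel_subset_staircase[OF V _ E])
      (auto simp: admissible_data_def unimodal_abs V)
  then have "(sign_val (sg x) * \<bar>x\<bar>, sign_val (sg y) * \<bar>y\<bar>) \<in> polygon_of_data D"
    unfolding polygon_of_data_def by (intro UN_I[OF UNIV_I]) (force intro: rev_image_eqI)
  then show ?thesis
    by (simp add: sg)
qed

section \<open>States at the boundary of the polygon\<close>

lemma sides_disjoint_interior:
  "right_side P \<inter> interior P = {}" "left_side P \<inter> interior P = {}"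
  "top_side P \<inter> interior P = {}" "bottom_side P \<inter> interior P = {}"
proof -
  \<comment> \<open>\<open>Q\<close> is the half-plane condition of a side and \<open>v\<close> the
    outward direction. Near an interior point \<open>Q\<close> would hold everywhere, yet it fails
    at arbitrarily small outward displacements.\<close>
  have *: False
    if q: "q \<in> interior P" and ev: "\<forall>\<^sub>F r in nhds q. r \<in> P \<longleftrightarrow> Q r"
      and v: "\<And>h. 0 < h \<Longrightarrow> \<not> Q (q + h *\<^sub>R v)" for q v :: "real \<times> real" and Q
  proof -
    have "\<forall>\<^sub>F r in nhds q. r \<in> interior P"
      using q by (intro eventually_nhds_in_open) auto
    with ev have ev': "\<forall>\<^sub>F r in nhds q. Q r"
      by eventually_elim (use interior_subset in blast)
    have "((\<lambda>h. q + h *\<^sub>R v) \<longlongrightarrow> q + 0 *\<^sub>R v) (at_right 0)"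
      by (intro tendsto_intros)
    then have "\<forall>\<^sub>F h in at_right 0. Q (q + h *\<^sub>R v)"
      using eventually_compose_filterlim[OF ev', of "\<lambda>h. q + h *\<^sub>R v"] by simp
    moreover have "\<forall>\<^sub>F h in at_right (0::real). 0 < h"
      by (simp add: eventually_at_right_less)
    ultimately have "\<forall>\<^sub>F h in at_right (0::real). False"
      by eventually_elim (use v in blast)
    then show False
      by (simp add: trivial_limit_at_right_real eventually_False)
  qed
  show "right_side P \<inter> interior P = {}"
    using *[where v = "(1, 0)"] by (force simp: right_side_def)
  show "left_side P \<inter> interior P = {}"
    using *[where v = "(-1, 0)"] by (force simp: left_side_def)
  show "top_side P \<inter> interior P = {}"
    using *[where v = "(0, 1)"] by (force simp: top_side_def)
  show "bottom_side P \<inter> interior P = {}"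
    using *[where v = "(0, -1)"] by (force simp: bottom_side_def)
qed

text \<open>Points of potential energy below \<open>E\<close> form an open subset of
  \<open>P\<close>. Off the interior the potential energy is thus at least \<open>E\<close>, which
  leaves no kinetic energy.\<close>

lemma momentum_zero_off_interior:
  assumes V: "unimodal V1" "unimodal V2"
    and sub: "{(x, y). V1 x + V2 y \<le> E} \<subseteq> P"
    and z: "z \<in> level_set V1 V2 E E1" and off: "pos z \<notin> interior P"
  shows "momentum z = (0, 0)"
proof -
  obtain px x py y where zz: "z = (px, x, py, y)"
    by (cases z)
  have en: "px\<^sup>2 / 2 + V1 x = E1" "py\<^sup>2 / 2 + V2 y = E - E1"
    using z by (auto simp: zz level_set_def)
  let ?U = "{q :: real \<times> real. V1 (fst q) + V2 (snd q) < E}"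
  have "continuous_on UNIV (\<lambda>q :: real \<times> real. V1 (fst q))"
    "continuous_on UNIV (\<lambda>q :: real \<times> real. V2 (snd q))"
    using continuous_on_compose2[OF unimodal_continuous_on[OF V(1)] continuous_on_fst[OF continuous_on_id]]
      continuous_on_compose2[OF unimodal_continuous_on[OF V(2)] continuous_on_snd[OF continuous_on_id]]
    by auto
  then have "open ?U"
    by (intro open_Collect_less continuous_on_add continuous_on_const)
  moreover have "?U \<subseteq> P"
    using sub by force
  ultimately have "(x, y) \<notin> ?U"
    using off interior_maximal[of ?U P] zz by force
  then have "px\<^sup>2 + py\<^sup>2 \<le> 0"
    using en by simp
  then show ?thesis
    using zz by (simp add: sum_power2_le_zero_iff)
qed

text \<open>In the interior there are neither corners nor sides. Elsewhere the momentum vanishes,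
  and both \<open>hits_corner\<close> and every case of \<open>reflect\<close> that changes the
  state ask for nonzero momentum.\<close>

lemma level_set_no_impact:
  assumes V: "unimodal V1" "unimodal V2"
    and sub: "{(x, y). V1 x + V2 y \<le> E} \<subseteq> P"
    and z: "z \<in> level_set V1 V2 E E1"
  shows "pos z \<in> P" and "\<not> hits_corner P z" and "reflect P z = z"
proof -
  note zero = momentum_zero_off_interior[OF V sub z]
  obtain px x py y where zz: "z = (px, x, py, y)"
    by (cases z)
  have "0 \<le> px\<^sup>2" "0 \<le> py\<^sup>2"
    by auto
  then have "V1 x + V2 y \<le> E"
    using z unfolding zz level_set_def mem_Collect_eq prod.case by linarith
  then show "pos z \<in> P"
    using sub zz by auto
  show "\<not> hits_corner P z"
    using zero by (auto simp: hits_corner_def corners_def frontier_def)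
  show "reflect P z = z"
    using zero sides_disjoint_interior[of P] by (auto simp: zz)
qed

section \<open>Motions with and without impacts\<close>

lemma solves_on_iff:
  "solves_on V1 V2 I c \<longleftrightarrow> (\<forall>t\<in>I.
     ((\<lambda>s. fst (c s)) has_real_derivative - deriv V1 (fst (snd (c t)))) (at t within I) \<and>
     ((\<lambda>s. fst (snd (c s))) has_real_derivative fst (c t)) (at t within I) \<and>
     ((\<lambda>s. fst (snd (snd (c s)))) has_real_derivative - deriv V2 (snd (snd (snd (c t))))) (at t within I) \<and>
     ((\<lambda>s. snd (snd (snd (c s)))) has_real_derivative fst (snd (snd (c t)))) (at t within I))"
proof -
  have pair: "(f has_vector_derivative v) (at t within I) \<longleftrightarrow>
      ((\<lambda>s. fst (f s)) has_vector_derivative fst v) (at t within I) \<and>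
      ((\<lambda>s. snd (f s)) has_vector_derivative snd v) (at t within I)"
    for f :: "real \<Rightarrow> 'a::real_normed_vector \<times> 'b::real_normed_vector" and v t
    using bounded_linear.has_vector_derivative[OF bounded_linear_fst, of f v "at t within I"]
      bounded_linear.has_vector_derivative[OF bounded_linear_snd, of f v "at t within I"]
      has_vector_derivative_Pair[of "\<lambda>s. fst (f s)" "fst v" t I "\<lambda>s. snd (f s)" "snd v"]
    by auto
  have field: "ham_field V1 V2 z =
      (- deriv V1 (fst (snd z)), fst z, - deriv V2 (snd (snd (snd z))), fst (snd (snd z)))" for z
    by (cases z) simp
  show ?thesis
    unfolding solves_on_def field
    by (simp add: pair has_real_derivative_iff_has_vector_derivative conj_assoc)
qed

lemma solves_on_subset: "solves_on V1 V2 I c \<Longrightarrow> J \<subseteq> I \<Longrightarrow> solves_on V1 V2 J c"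
  unfolding solves_on_def by (meson has_vector_derivative_within_subset subsetD)

text \<open>The two degrees of freedom are uncoupled, so each conserves its own energy. Any convex
  set of times is allowed, which covers the half-open intervals in the law of impacts.\<close>

lemma solves_on_energy:
  assumes D1: "\<And>x. (V1 has_real_derivative deriv V1 x) (at x)"
    and D2: "\<And>x. (V2 has_real_derivative deriv V2 x) (at x)"
    and c: "solves_on V1 V2 I c" and I: "convex I" "s \<in> I" "t \<in> I"
    and L: "c s \<in> level_set V1 V2 E E1"
  shows "c t \<in> level_set V1 V2 E E1"
proof -
  define H where "H V p q u = (p u)\<^sup>2 / 2 + V (q u)"
    for V :: "real \<Rightarrow> real" and p q :: "real \<Rightarrow> real" and u
  have const: "H V p q t = H V p q s"
    if V: "\<And>x. (V has_real_derivative deriv V x) (at x)"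
      and p: "\<And>u. u \<in> I \<Longrightarrow> (p has_real_derivative - deriv V (q u)) (at u within I)"
      and q: "\<And>u. u \<in> I \<Longrightarrow> (q has_real_derivative p u) (at u within I)"
    for V p q
  proof -
    \<comment> \<open>The kinetic and the potential part contribute
      \<open>- p u * deriv V (q u)\<close> and \<open>deriv V (q u) * p u\<close>.\<close>
    have "(H V p q has_real_derivative 0) (at u within I)" if "u \<in> I" for u
      unfolding H_def
      by (rule derivative_eq_intros p[OF that] q[OF that] DERIV_chain2[OF V] refl | simp)+
    then have "\<exists>k. \<forall>u\<in>I. H V p q u = k"
      using I(1) by (intro has_field_derivative_zero_constant) auto
    then show ?thesis
      using I by auto
  qed
  have "H V1 (\<lambda>u. fst (c u)) (\<lambda>u. fst (snd (c u))) t = H V1 (\<lambda>u. fst (c u)) (\<lambda>u. fst (snd (c u))) s"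
    using c by (intro const D1) (auto simp: solves_on_iff)
  moreover have "H V2 (\<lambda>u. fst (snd (snd (c u)))) (\<lambda>u. snd (snd (snd (c u)))) t =
      H V2 (\<lambda>u. fst (snd (snd (c u)))) (\<lambda>u. snd (snd (snd (c u)))) s"
    using c by (intro const D2) (auto simp: solves_on_iff)
  ultimately show ?thesis
    using L unfolding H_def level_set_def by (auto simp: case_prod_beta)
qed

lemma time_reversal_level_set:
  "time_reversal z \<in> level_set V1 V2 E E1 \<longleftrightarrow> z \<in> level_set V1 V2 E E1"
  by (cases z) (simp add: level_set_def)

text \<open>Reversing time flips the sign of a derivative. For positions this matches the negated
  momenta; for momenta the two sign changes cancel.\<close>

lemma solves_on_time_reversal:
  assumes "solves_on V1 V2 I c"
  shows "solves_on V1 V2 (uminus ` I) (\<lambda>t. time_reversal (c (- t)))"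
proof -
  have TR: "time_reversal z = (- fst z, fst (snd z), - fst (snd (snd z)), snd (snd (snd z)))" for z
    by (cases z) simp
  have mirror: "((\<lambda>s. f (- s)) has_real_derivative - D) (at t within uminus ` I)"
    if "(f has_real_derivative D) (at (- t) within I)" for f D t
  proof -
    have "(uminus has_real_derivative - 1) (at t within uminus ` I)"
      by (auto intro!: derivative_eq_intros)
    then show ?thesis
      using DERIV_image_chain[of f D uminus t "uminus ` I" "- 1"] that
      by (simp add: image_image o_def)
  qed
  show ?thesis
    unfolding solves_on_iff
  proof (intro ballI conjI)
    fix t assume "t \<in> uminus ` I"
    then have "- t \<in> I" by auto
    with assms have
      d1: "((\<lambda>s. fst (c s)) has_real_derivative - deriv V1 (fst (snd (c (- t))))) (at (- t) within I)" and
      d2: "((\<lambda>s. fst (snd (c s))) has_real_derivative fst (c (- t))) (at (- t) within I)" and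
      d3: "((\<lambda>s. fst (snd (snd (c s)))) has_real_derivative
        - deriv V2 (snd (snd (snd (c (- t)))))) (at (- t) within I)" and
      d4: "((\<lambda>s. snd (snd (snd (c s)))) has_real_derivative fst (snd (snd (c (- t))))) (at (- t) within I)"
      by (auto simp: solves_on_iff)
    let ?b = "\<lambda>t. time_reversal (c (- t))"
    show "((\<lambda>s. fst (?b s)) has_real_derivative - deriv V1 (fst (snd (?b t)))) (at t within uminus ` I)"
      using DERIV_minus[OF mirror[OF d1]] by (simp add: TR)
    show "((\<lambda>s. fst (snd (?b s))) has_real_derivative fst (?b t)) (at t within uminus ` I)"
      using mirror[OF d2] by (simp add: TR)
    show "((\<lambda>s. fst (snd (snd (?b s)))) has_real_derivative
        - deriv V2 (snd (snd (snd (?b t))))) (at t within uminus ` I)"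
      using DERIV_minus[OF mirror[OF d3]] by (simp add: TR)
    show "((\<lambda>s. snd (snd (snd (?b s)))) has_real_derivative fst (snd (snd (?b t))))
        (at t within uminus ` I)"
      using mirror[OF d4] by (simp add: TR)
  qed
qed

section \<open>Equivalence of motions with and without impacts\<close>

lemma forward_impact_motion_left:
  assumes "forward_impact_motion V1 V2 P c" "0 < t" "\<And>s. 0 \<le> s \<Longrightarrow> s < t \<Longrightarrow> \<not> hits_corner P (c s)"
  obtains e where "0 < e" "e \<le> t" "solves_on V1 V2 {t - e<..t} c"
proof -
  have "\<forall>s\<in>{0..<t}. \<not> hits_corner P (c s)"
    using assms(3) by simp
  then have "\<exists>e>0. e \<le> t \<and> solves_on V1 V2 {t - e<..t} c"
    using assms(1,2) unfolding forward_impact_motion_def by blast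
  then show thesis
    using that by blast
qed

lemma forward_impact_motion_right:
  assumes "forward_impact_motion V1 V2 P c" "0 \<le> t" "\<not> hits_corner P (c t)"
  obtains e where "0 < e" "solves_on V1 V2 {t..<t + e} (c(t := reflect P (c t)))"
proof -
  have "\<exists>e>0. solves_on V1 V2 {t..<t + e} (c(t := reflect P (c t)))"
    using assms unfolding forward_impact_motion_def by blast
  then show thesis
    using that by blast
qed

context
  fixes V1 V2 :: "real \<Rightarrow> real" and P :: "(real \<times> real) set" and E E1 :: real
  assumes V: "unimodal V1" "unimodal V2"
    and sub: "{(x, y). V1 x + V2 y \<le> E} \<subseteq> P"
begin

lemmas no_impact = level_set_no_impact[OF V sub]
lemmas energy = solves_on_energy[OF unimodal_has_derivative[OF V(1)] unimodal_has_derivative[OF V(2)]]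

text \<open>Energy conservation keeps the solution on the level set, where no corner is hit and the
  reflected update of \<open>c\<close> is \<open>c\<close> itself.\<close>

lemma solution_forward_impact_motion:
  assumes c: "solves_on V1 V2 UNIV c" and L: "c 0 \<in> level_set V1 V2 E E1"
  shows "forward_impact_motion V1 V2 P c"
proof -
  have ct: "c t \<in> level_set V1 V2 E E1" for t
    using energy[OF c _ _ _ L] by simp
  have sub': "solves_on V1 V2 J c" for J
    using solves_on_subset[OF c] by simp
  have "c(t := reflect P (c t)) = c" for t
    using no_impact(3)[OF ct] by simp
  then show ?thesis
    unfolding forward_impact_motion_def
    using no_impact(1,2)[OF ct] sub' by (auto intro: exI[of _ 1] simp: gt_ex)
qed

text \<open>While the state stays on the level set there is neither an impact nor a stop, so the set of times
  up to which it does so is closed and open in \<open>[0, \<infinity>)\<close>.\<close>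

lemma forward_impact_motion_level_set:
  assumes c: "forward_impact_motion V1 V2 P c" and L0: "c 0 \<in> level_set V1 V2 E E1" and t: "0 \<le> t"
  shows "c t \<in> level_set V1 V2 E E1"
proof (rule ccontr)
  let ?L = "level_set V1 V2 E E1"
  assume "c t \<notin> ?L"
  define B where "B = {s. 0 \<le> s \<and> c s \<notin> ?L}"
  \<comment> \<open>The supposed first exit time from the level set.\<close>
  define T where "T = Inf B"
  have B: "B \<noteq> {}" "bdd_below B"
    using \<open>c t \<notin> ?L\<close> t by (auto simp: B_def bdd_below_def)
  have T0: "0 \<le> T"
    unfolding T_def using B by (intro cInf_greatest) (auto simp: B_def)
  have before: "c s \<in> ?L" if "0 \<le> s" "s < T" for s
    using cInf_lower[OF _ B(2), of s] that by (force simp: B_def T_def)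
  have cT: "c T \<in> ?L"
  proof (cases "T = 0")
    case True
    with L0 show ?thesis by simp
  next
    case False
    then obtain e where e: "e > 0" "e \<le> T" "solves_on V1 V2 {T - e<..T} c"
      using forward_impact_motion_left[OF c, of T] T0 no_impact(2)[OF before] by auto
    \<comment> \<open>At the time \<open>T - e / 2\<close> the state is still on the level set, and
      the equations hold up to and including \<open>T\<close>, so conservation reaches
      \<open>T\<close>.\<close>
    show ?thesis
      by (rule energy[OF e(3) _ _ _ before[of "T - e / 2"]]) (use e in auto)
  qed
  \<comment> \<open>No reflection occurs at \<open>T\<close>, so \<open>c\<close> itself continues
    as a solution and stays on the level set beyond \<open>T\<close>, against the choice of
    \<open>T\<close> as an infimum.\<close>
  then obtain e where e: "e > 0" "solves_on V1 V2 {T..<T + e} c"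
    using forward_impact_motion_right[OF c T0 no_impact(2)[OF cT]] no_impact(3)[OF cT] by auto
  have after: "c s \<in> ?L" if "s \<in> {T..<T + e}" for s
    by (rule energy[OF e(2) _ _ _ cT]) (use that e(1) in auto)
  obtain s where "s \<in> B" "s < T + e"
    using cInf_lessD[OF B(1), of "T + e"] e(1) by (auto simp: T_def)
  then show False
    using before[of s] after[of s] by (force simp: B_def)
qed

text \<open>On the level set the clauses of the law of impacts reduce to one-sided equations; at
  time 0 the forward motion supplies only the right one.\<close>

lemma forward_impact_motion_derivative:
  assumes c: "forward_impact_motion V1 V2 P c" and L0: "c 0 \<in> level_set V1 V2 E E1"
  shows "0 \<le> t \<Longrightarrow> \<exists>e>0. solves_on V1 V2 {t..<t + e} c"
    and "0 < t \<Longrightarrow> \<exists>e>0. solves_on V1 V2 {t - e<..t} c"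
proof -
  note L = forward_impact_motion_level_set[OF c L0]
  show "\<exists>e>0. solves_on V1 V2 {t..<t + e} c" if "0 \<le> t"
    using forward_impact_motion_right[OF c that no_impact(2)[OF L[OF that]]] no_impact(3)[OF L[OF that]]
    by auto
  show "\<exists>e>0. solves_on V1 V2 {t - e<..t} c" if "0 < t"
    using forward_impact_motion_left[OF c that] no_impact(2)[OF L] by blast
qed

text \<open>The forward motion gives both one-sided equations at positive times and the right one at
  0; the reversed motion supplies the rest. Both sides involve the same field value, so they join to
  a two-sided derivative.\<close>

lemma impact_motion_iff:
  assumes L0: "c 0 \<in> level_set V1 V2 E E1"
  shows "impact_motion V1 V2 P c \<longleftrightarrow> solves_on V1 V2 UNIV c"
proof
  let ?b = "\<lambda>t. time_reversal (c (- t))"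
  have Lb: "?b 0 \<in> level_set V1 V2 E E1"
    using L0 by (simp add: time_reversal_level_set)
  {
    assume c: "solves_on V1 V2 UNIV c"
    then have "solves_on V1 V2 (uminus ` UNIV) ?b"
      by (rule solves_on_time_reversal)
    then have "solves_on V1 V2 UNIV ?b"
      by (simp add: surj_uminus)
    then show "impact_motion V1 V2 P c"
      unfolding impact_motion_def
      using solution_forward_impact_motion[OF c L0]
        solution_forward_impact_motion[where c = ?b, OF _ Lb] by blast
  }
  assume "impact_motion V1 V2 P c"
  then have fwd: "forward_impact_motion V1 V2 P c" and bwd: "forward_impact_motion V1 V2 P ?b"
    by (auto simp: impact_motion_def)
  \<comment> \<open>Time reversal is an involution, so solutions transfer back from
    \<open>?b\<close> to \<open>c\<close>, with left and right neighbourhoods exchanged.\<close>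
  have reverse: "solves_on V1 V2 (uminus ` I) c" if "solves_on V1 V2 I ?b" for I
  proof -
    have "time_reversal (time_reversal z) = z" for z
      by (cases z) simp
    then show ?thesis
      using solves_on_time_reversal[OF that] by simp
  qed
  have right: "\<exists>e>0. solves_on V1 V2 {t..<t + e} c" for t
  proof (cases "0 \<le> t")
    case True
    then show ?thesis
      using forward_impact_motion_derivative(1)[OF fwd L0] by blast
  next
    case False
    then obtain e where "e > 0" "solves_on V1 V2 {- t - e<..- t} ?b"
      using forward_impact_motion_derivative(2)[where c = ?b, OF bwd Lb, of "- t"] by auto
    moreover have "uminus ` {- t - e<..- t} = {t..<t + e}"
      by (simp add: add.commute)
    ultimately show ?thesis
      using reverse by metis
  qed
  have left: "\<exists>e>0. solves_on V1 V2 {t - e<..t} c" for t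
  proof (cases "0 < t")
    case True
    then show ?thesis
      using forward_impact_motion_derivative(2)[OF fwd L0] by blast
  next
    case False
    then obtain e where "e > 0" "solves_on V1 V2 {- t..<- t + e} ?b"
      using forward_impact_motion_derivative(1)[where c = ?b, OF bwd Lb, of "- t"] by auto
    moreover have "uminus ` {- t..<- t + e} = {t - e<..t}"
      by simp
    ultimately show ?thesis
      using reverse by metis
  qed
  show "solves_on V1 V2 UNIV c"
    unfolding solves_on_def
  proof
    fix t :: real
    let ?v = "ham_field V1 V2 (c t)"
    obtain e1 where e1: "e1 > 0" "(c has_vector_derivative ?v) (at t within {t..<t + e1})"
      using right[of t] by (auto simp: solves_on_def)
    obtain e2 where e2: "e2 > 0" "(c has_vector_derivative ?v) (at t within {t - e2<..t})"
      using left[of t] by (auto simp: solves_on_def)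
    have "(c has_vector_derivative ?v) (at t within {t - e2<..t} \<union> {t..<t + e1})"
      using e1 e2 unfolding has_vector_derivative_def has_derivative_within
      by (auto simp: Lim_within_Un)
    moreover have "{t - e2<..t} \<union> {t..<t + e1} = {t - e2<..<t + e1}"
      using e1 e2 by auto
    ultimately show "(c has_vector_derivative ?v) (at t)"
      using has_vector_derivative_within_open[of t "{t - e2<..<t + e1}" c ?v] e1(1) e2(1) by auto
  qed
qed

text \<open>The condition \<open>c 0 = z\<close> places the start on the level set, so both definite
  descriptions range over equivalent predicates.\<close>

lemma impact_flow_eq_flow:
  assumes "z \<in> level_set V1 V2 E E1"
  shows "impact_flow V1 V2 P t z = flow V1 V2 t z"
proof -
  have "(impact_motion V1 V2 P c \<and> c 0 = z) = (solves_on V1 V2 UNIV c \<and> c 0 = z)" for c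
    using impact_motion_iff[of c] assms by blast
  then show ?thesis
    by (simp add: impact_flow_def flow_def)
qed

end

section \<open>Quadratic potentials\<close>

text \<open>The solution through \<open>z\<close> of two uncoupled harmonic oscillators with angular
  frequencies \<open>a\<close> and \<open>b\<close>.\<close>

definition oscillator :: "real \<Rightarrow> real \<Rightarrow> state \<Rightarrow> real \<Rightarrow> state" where
  "oscillator a b z t = (case z of (px, x, py, y) \<Rightarrow>
     (px * cos (a * t) - a * x * sin (a * t), x * cos (a * t) + px / a * sin (a * t),
      py * cos (b * t) - b * y * sin (b * t), y * cos (b * t) + py / b * sin (b * t)))"

lemma quadratic_has_derivative:
  assumes "\<And>x. V x = 1/2 * w\<^sup>2 * x\<^sup>2"
  shows "(V has_real_derivative w\<^sup>2 * x) (at x)"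
proof -
  have "V = (\<lambda>x. 1/2 * w\<^sup>2 * x\<^sup>2)"
    using assms by auto
  then show ?thesis
    by (auto intro!: derivative_eq_intros)
qed

text \<open>The equations are linear, so the difference of two solutions is a solution. If they
  start at the same state, its energies are 0 at time 0 and remain so; being positive definite, they
  force the difference to vanish.\<close>

lemma flow_quadratic:
  assumes a: "a > 0" and b: "b > 0"
    and V1: "\<And>x. V1 x = 1/2 * a\<^sup>2 * x\<^sup>2" and V2: "\<And>x. V2 x = 1/2 * b\<^sup>2 * x\<^sup>2"
  shows "flow V1 V2 t z = oscillator a b z t"
proof -
  note dV = quadratic_has_derivative[of V1 a, OF V1] quadratic_has_derivative[of V2 b, OF V2]
  have [simp]: "deriv V1 x = a\<^sup>2 * x" "deriv V2 x = b\<^sup>2 * x" for x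
    using dV by (auto intro: DERIV_imp_deriv)
  have sol: "solves_on V1 V2 UNIV (oscillator a b z)"
    using a b unfolding solves_on_iff oscillator_def
    by (auto split: prod.splits intro!: derivative_eq_intros
        simp: algebra_simps power2_eq_square)
  have init: "oscillator a b z 0 = z"
    by (cases z) (simp add: oscillator_def)
  have "c = oscillator a b z" if c: "solves_on V1 V2 UNIV c" "c 0 = z" for c
  proof
    fix t
    define d where "d s = c s - oscillator a b z s" for s
    have "solves_on V1 V2 UNIV d"
      using c(1) sol unfolding solves_on_iff d_def
      by (auto simp: right_diff_distrib intro!: derivative_eq_intros)
    moreover have "d 0 \<in> level_set V1 V2 0 0"
      using c(2) init by (simp add: d_def level_set_def V1 V2 zero_prod_def)
    ultimately have dt: "d t \<in> level_set V1 V2 0 0"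
      using solves_on_energy[of V1 V2 UNIV d 0 t 0 0] dV by simp
    have zero: "p = 0 \<and> q = 0" if "p\<^sup>2 / 2 + 1/2 * w\<^sup>2 * q\<^sup>2 = 0" "w > 0" for p q w :: real
    proof -
      have "p\<^sup>2 + (w * q)\<^sup>2 = 0"
        using that(1) by (simp add: power_mult_distrib)
      then show ?thesis
        using that(2) by (simp add: sum_power2_eq_zero_iff)
    qed
    obtain px x py y where "d t = (px, x, py, y)"
      by (cases "d t")
    then have "d t = 0"
      using dt zero[of px a x] zero[of py b y] a b unfolding zero_prod_def
      by (simp add: level_set_def V1 V2)
    then show "c t = oscillator a b z t"
      by (simp add: d_def)
  qed
  then have "(THE c. solves_on V1 V2 UNIV c \<and> c 0 = z) = oscillator a b z"
    using sol init by (intro the_equality) blast+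
  then show ?thesis
    by (simp add: flow_def)
qed

text \<open>With \<Omega> equal to \<open>m / n\<close>, the first oscillator completes
  \<open>m\<close> turns while the second completes \<open>n\<close>.\<close>

lemma oscillator_periodic:
  assumes b: "b > 0" and \<Omega>: "\<Omega> > 0" "\<Omega> \<in> \<rat>"
  shows "\<exists>T>0. \<forall>t z. oscillator (\<Omega> * b) b z (t + T) = oscillator (\<Omega> * b) b z t"
proof -
  obtain m n :: nat where mn: "n \<noteq> 0" "\<bar>\<Omega>\<bar> = real m / real n"
    using Rats_abs_nat_div_natE[OF \<Omega>(2)] by metis
  \<comment> \<open>This is \<open>n\<close> periods \<open>2 * pi / b\<close> of the second
    oscillator, independent of the initial state.\<close>
  define T where "T = 2 * pi * real n / b"
  have T: "b * (t + T) = b * t + 2 * pi * real n" "\<Omega> * b * (t + T) = \<Omega> * b * t + 2 * pi * real m" for t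
    using b \<Omega>(1) mn by (auto simp: T_def field_simps)
  have per: "sin (x + 2 * pi * real j) = sin x" "cos (x + 2 * pi * real j) = cos x" for x j
    using sin_cos_eq_iff[of "x + 2 * pi * real j" x] by (auto intro!: exI[of _ "int j"])
  have "T > 0"
    using b mn by (simp add: T_def)
  moreover have "oscillator (\<Omega> * b) b z (t + T) = oscillator (\<Omega> * b) b z t" for t z
    unfolding oscillator_def T per ..
  ultimately show ?thesis
    by blast
qed

section \<open>Coincidence of the flows and periodicity\<close>

theorem proposition1p3:
  fixes V1 V2 :: "real \<Rightarrow> real"
    and D :: "sign \<Rightarrow> sign \<Rightarrow> (real \<times> real) list"
    and P :: "(real \<times> real) set"
    and E :: real
  assumes "unimodal V1" and "unimodal V2"
    and "admissible_data D" and "P = polygon_of_data D"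
    and "E > 0"
    and "E \<le> Min {V1 (xc (D s1 s2) k) + V2 (yc (D s1 s2) (k + 1)) | s1 s2 k. k \<le> length (D s1 s2)}"
  shows "(\<forall>E1\<in>{0..E}.
            impact_level_set V1 V2 P E E1 = level_set V1 V2 E E1 \<and>
            (\<forall>t. \<forall>z\<in>level_set V1 V2 E E1. impact_flow V1 V2 P t z = flow V1 V2 t z))
       \<and> (\<forall>\<Omega>>0. quadratic V1 \<and> quadratic V2 \<and> (\<forall>x. V1 x = \<Omega>\<^sup>2 * V2 x) \<and> \<Omega> \<in> \<rat> \<longrightarrow>
            (\<forall>E1\<in>{0..E}. \<forall>z\<in>impact_level_set V1 V2 P E E1.
               \<exists>T>0. \<forall>t. impact_flow V1 V2 P (t + T) z = impact_flow V1 V2 P t z))"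
proof -
  let ?M = "{V1 (xc (D s1 s2) k) + V2 (yc (D s1 s2) (k + 1)) | s1 s2 k. k \<le> length (D s1 s2)}"
  \<comment> \<open>Finitely many signs and indices occur, so \<open>Min ?M\<close> is a genuine
    lower bound.\<close>
  have "?M = (\<Union>s1\<in>{Plus, Minus}. \<Union>s2\<in>{Plus, Minus}. \<Union>k\<in>{..length (D s1 s2)}.
      {V1 (xc (D s1 s2) k) + V2 (yc (D s1 s2) (k + 1))})"
    using sign.exhaust by blast
  then have fin: "finite ?M"
    by simp
  have bound: "E \<le> V1 (xc (D s1 s2) k) + V2 (yc (D s1 s2) (k + 1))" if "k \<le> length (D s1 s2)"
    for s1 s2 k
  proof -
    have "Min ?M \<le> V1 (xc (D s1 s2) k) + V2 (yc (D s1 s2) (k + 1))"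
      using that by (intro Min_le[OF fin]) blast
    with assms(6) show ?thesis by linarith
  qed
  have sub: "{(x, y). V1 x + V2 y \<le> E} \<subseteq> P"
    using sublevel_subset_polygon[OF assms(1,2,3) bound] assms(4) by auto
  have levels: "impact_level_set V1 V2 P E E1 = level_set V1 V2 E E1" for E1
    using level_set_no_impact(1)[OF assms(1,2) sub] by (auto simp: impact_level_set_def)
  note flows = impact_flow_eq_flow[OF assms(1,2) sub]
  have "\<exists>T>0. \<forall>t. impact_flow V1 V2 P (t + T) z = impact_flow V1 V2 P t z"
    if \<Omega>: "\<Omega> > 0" "\<Omega> \<in> \<rat>" and q: "quadratic V1" "quadratic V2" and V12: "\<forall>x. V1 x = \<Omega>\<^sup>2 * V2 x"
      and z: "z \<in> impact_level_set V1 V2 P E E1" for \<Omega> E1 z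
  proof -
    obtain b where b: "b > 0" "\<And>x. V2 x = 1/2 * b\<^sup>2 * x\<^sup>2"
      using q(2) by (auto simp: quadratic_def)
    \<comment> \<open>The frequency in the x-direction is \<open>\<Omega> * b\<close>, hence a
      rational multiple of the one in the y-direction.\<close>
    have V1: "V1 x = 1/2 * (\<Omega> * b)\<^sup>2 * x\<^sup>2" for x
      using V12 b(2) by (simp add: power_mult_distrib)
    have "flow V1 V2 t z = oscillator (\<Omega> * b) b z t" for t
      using flow_quadratic[OF _ b(1) V1 b(2)] \<Omega>(1) b(1) by simp
    then show ?thesis
      using oscillator_periodic[OF b(1) \<Omega>] flows[OF z[unfolded levels]] by metis
  qed
  with levels flows show ?thesis
    by blast
qed

end
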